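(* Let $a\ge1$, $b\ge2$, $n\ge1$ be integers and let $G_{a,b,n}=\overline{K}_a\nabla(nB_b)$. Then the induced matching number of $G_{a,b,n}$ is $$\nu(G_{a,b,n})=\begin{cases} n, & b=2,3,\\ 2n, & b\ge4.\end{cases}$$
   Context: All graphs are finite, simple and undirected. For $b\ge 2$, $B_b$ is the graph with vertices $x_1,\dots,x_b,y_1,\dots,y_b$ and edges $\{x_i,x_j\}$ and $\{y_i,y_j\}$ for $1\le i<j\le b$, and $\{x_i,y_i\}$ for $1\le i\le b$. $nB_b$ is the disjoint union of $n$ copies of $B_b$. The join $G\nabla H$ of graphs on disjoint vertex sets is obtained from the disjoint union by adding every edge between $V(G)$ and $V(H)$. $\overline{K}_a$ is the edgeless graph on $a$ vertices. The induced matching number $\nu(G)$ is the maximum number of edges in an induced matching of $G$, i.e. a set of pairwise disjoint edges such that the subgraph induced on their endpoints has no other edges. *)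

theory Defs imports Main begin

record 'a graph =
  verts :: "'a set"
  edges :: "'a set set"

definition simple_graph :: "'a graph \<Rightarrow> bool" where
  "simple_graph G \<longleftrightarrow> finite (verts G) \<and> edges G \<subseteq> {e. e \<subseteq> verts G \<and> card e = 2}"

definition induced_subgraph :: "'a graph \<Rightarrow> 'a set \<Rightarrow> 'a graph" where
  "induced_subgraph G S = \<lparr>verts = verts G \<inter> S, edges = {e \<in> edges G. e \<subseteq> S}\<rparr>"

definition induced_matching :: "'a graph \<Rightarrow> 'a set set \<Rightarrow> bool" where
  "induced_matching G M \<longleftrightarrow>
     M \<subseteq> edges G \<and>
     (\<forall>e\<in>M. \<forall>f\<in>M. e \<noteq> f \<longrightarrow> e \<inter> f = {}) \<and>
     edges (induced_subgraph G (\<Union>M)) = M"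

text \<open>The empty matching is always induced, and a finite graph has only finitely many
  induced matchings, so the maximum below is taken over a finite nonempty set.\<close>

definition induced_matching_number :: "'a graph \<Rightarrow> nat" where
  "induced_matching_number G = Max {card M | M. induced_matching G M}"

definition edgeless :: "nat \<Rightarrow> nat graph" where
  "edgeless a = \<lparr>verts = {1..a}, edges = {}\<rparr>"

datatype bvert = X nat | Y nat

definition B_graph :: "nat \<Rightarrow> bvert graph" where
  "B_graph b =
     \<lparr>verts = X ` {1..b} \<union> Y ` {1..b},
      edges = {{X i, X j} | i j. 1 \<le> i \<and> i < j \<and> j \<le> b}
            \<union> {{Y i, Y j} | i j. 1 \<le> i \<and> i < j \<and> j \<le> b}
            \<union> {{X i, Y i} | i. 1 \<le> i \<and> i \<le> b}\<rparr>"

text \<open>The pair \<open>(k, v)\<close> is the vertex \<open>v\<close> of the \<open>k\<close>-th copy.\<close>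

definition copies :: "nat \<Rightarrow> 'a graph \<Rightarrow> (nat \<times> 'a) graph" where
  "copies n G =
     \<lparr>verts = {1..n} \<times> verts G,
      edges = {Pair k ` e | k e. k \<in> {1..n} \<and> e \<in> edges G}\<rparr>"

text \<open>The sum type makes the two vertex sets disjoint.\<close>

definition graph_join :: "'a graph \<Rightarrow> 'b graph \<Rightarrow> ('a + 'b) graph" (infixl \<open>\<nabla>\<close> 65) where
  "G \<nabla> H =
     \<lparr>verts = verts G <+> verts H,
      edges = (image Inl) ` edges G \<union> (image Inr) ` edges H
            \<union> {{Inl u, Inr v} | u v. u \<in> verts G \<and> v \<in> verts H}\<rparr>"

definition G_graph :: "nat \<Rightarrow> nat \<Rightarrow> nat \<Rightarrow> (nat + nat \<times> bvert) graph" where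
  "G_graph a b n = edgeless a \<nabla> copies n (B_graph b)"

lemma finite_induced_matchings:
  assumes "simple_graph G"
  shows "finite {M. induced_matching G M}"
proof -
  have "finite (edges G)"
    using assms by (auto simp: simple_graph_def intro: finite_subset[of _ "Pow (verts G)"])
  then show ?thesis
    by (auto simp: induced_matching_def intro: finite_subset[of _ "Pow (edges G)"])
qed

lemma induced_matching_empty:
  assumes "simple_graph G"
  shows "induced_matching G {}"
  using assms by (auto simp: induced_matching_def induced_subgraph_def simple_graph_def)

lemma simple_graph_edgeless: "simple_graph (edgeless a)"
  by (simp add: simple_graph_def edgeless_def)

lemma simple_graph_B_graph: "simple_graph (B_graph b)"
  by (auto simp: simple_graph_def B_graph_def card_insert_if)

lemma simple_graph_copies:
  assumes "simple_graph G"
  shows "simple_graph (copies n G)"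
  using assms by (fastforce simp: simple_graph_def copies_def card_image inj_on_def)

lemma simple_graph_join:
  assumes "simple_graph G" "simple_graph H"
  shows "simple_graph (G \<nabla> H)"
  using assms by (fastforce simp: simple_graph_def graph_join_def card_image inj_on_def card_insert_if)

lemma simple_graph_G_graph: "simple_graph (G_graph a b n)"
  unfolding G_graph_def
  by (intro simple_graph_join simple_graph_edgeless simple_graph_copies simple_graph_B_graph)

end

theory Submission imports Defs begin

text \<open>Two edges of an induced matching that share a vertex or are joined by an edge coincide.
  Every edge of $G_{a,b,n}$ meets one of the $2n$ cliques $\{x_i\}$, $\{y_i\}$ of the copies of
  $B_b$, so $\nu \le 2n$. If $b \le 3$, any two edges of $B_b$ touch, since the index pairs of an
  edge inside $\{x_i\}$ and of an edge inside $\{y_i\}$ share an index; as a vertex of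
  $\overline{K}_a$ is adjacent to all copies, any two edges of $G_{a,b,n}$ meeting the same copy
  touch as well, so $\nu \le n$. Conversely, the edges $x_1x_2$ (and, for $b \ge 4$, also
  $y_3y_4$) of all copies form an induced matching.\<close>

section \<open>Induced matchings in a general graph\<close>

lemma induced_matching_touching_eq:
  assumes M: "induced_matching G M" and e: "e \<in> M" "p \<in> e" and f: "f \<in> M" "q \<in> f"
    and touch: "p = q \<or> {p, q} \<in> edges G"
  shows "e = f"
proof -
  have disj: "g = h" if "g \<in> M" "h \<in> M" "r \<in> g" "r \<in> h" for g h r
    using M that unfolding induced_matching_def by blast
  show ?thesis
  proof (cases "p = q")
    case True
    then show ?thesis using disj e f by blast
  next
    case False
    \<comment> \<open>Both ends are covered by \<open>M\<close>, so the joining edge lies in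
      \<open>M\<close> itself; it meets \<open>e\<close> and \<open>f\<close>, hence equals
      both.\<close>
    then have "{p, q} \<in> edges (induced_subgraph G (\<Union>M))"
      using touch e f by (auto simp: induced_subgraph_def)
    then have "{p, q} \<in> M"
      using M by (simp add: induced_matching_def)
    then have "e = {p, q}" "f = {p, q}"
      using disj[of e "{p, q}" p] disj[of f "{p, q}" q] e f by auto
    then show ?thesis by simp
  qed
qed

lemma induced_matching_number_eqI:
  assumes "simple_graph G" "induced_matching G M"
    and "\<And>N. induced_matching G N \<Longrightarrow> card N \<le> card M"
  shows "induced_matching_number G = card M"
proof -
  have "finite {card N | N. induced_matching G N}"
    using finite_induced_matchings[OF assms(1)] by simp
  then show ?thesis
    unfolding induced_matching_number_def using assms(2,3) by (intro Max_eqI) auto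
qed

section \<open>Edges of \<open>B_graph b\<close>\<close>

lemma B_graph_XX: "i \<in> {1..b} \<Longrightarrow> j \<in> {1..b} \<Longrightarrow> i \<noteq> j \<Longrightarrow> {X i, X j} \<in> edges (B_graph b)"
  by (cases i j rule: linorder_cases) (auto simp: B_graph_def insert_commute)

lemma B_graph_YY: "i \<in> {1..b} \<Longrightarrow> j \<in> {1..b} \<Longrightarrow> i \<noteq> j \<Longrightarrow> {Y i, Y j} \<in> edges (B_graph b)"
  by (cases i j rule: linorder_cases) (auto simp: B_graph_def insert_commute)

lemma B_graph_XY: "i \<in> {1..b} \<Longrightarrow> {X i, Y i} \<in> edges (B_graph b)"
  by (auto simp: B_graph_def)

text \<open>Weakening \<open>i < j\<close> to \<open>i \<noteq> j\<close> makes the two indices of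
  an edge interchangeable in later case analyses.\<close>

lemma B_graph_edge_cases:
  assumes "e \<in> edges (B_graph b)"
  obtains (XX) i j where "e = {X i, X j}" "i \<in> {1..b}" "j \<in> {1..b}" "i \<noteq> j"
    | (YY) i j where "e = {Y i, Y j}" "i \<in> {1..b}" "j \<in> {1..b}" "i \<noteq> j"
    | (XY) i where "e = {X i, Y i}" "i \<in> {1..b}"
proof -
  consider i j where "e = {X i, X j}" "1 \<le> i" "i < j" "j \<le> b"
    | i j where "e = {Y i, Y j}" "1 \<le> i" "i < j" "j \<le> b"
    | i where "e = {X i, Y i}" "1 \<le> i" "i \<le> b"
    using assms unfolding B_graph_def by auto
  then show thesis
  proof cases
    case (1 i j)
    then show thesis using XX[of i j] by simp
  next
    case (2 i j)
    then show thesis using YY[of i j] by simp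
  next
    case (3 i)
    then show thesis using XY[of i] by simp
  qed
qed

text \<open>Two edges that both have a vertex among the \<open>X i\<close>, or both among the
  \<open>Y i\<close>, touch because these sets are cliques. This leaves an \<open>X\<close> edge
  against a \<open>Y\<close> edge, where \<open>b \<le> 3\<close> enters.\<close>

lemma B_graph_edges_touch:
  assumes "b \<le> 3" and e: "e \<in> edges (B_graph b)" and f: "f \<in> edges (B_graph b)"
  shows "\<exists>p\<in>e. \<exists>q\<in>f. p = q \<or> {p, q} \<in> edges (B_graph b)"
proof -
  have XX: "?thesis" if "X i \<in> e" "X j \<in> f" "i \<in> {1..b}" "j \<in> {1..b}" for i j
    using that B_graph_XX[of i b j] by blast
  have YY: "?thesis" if "Y i \<in> e" "Y j \<in> f" "i \<in> {1..b}" "j \<in> {1..b}" for i j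
    using that B_graph_YY[of i b j] by blast
  \<comment> \<open>Two 2-element subsets of a set with at most three elements intersect.\<close>
  have common: "i = k \<or> i = l \<or> j = k \<or> j = l"
    if "i \<in> {1..b}" "j \<in> {1..b}" "i \<noteq> j" "k \<in> {1..b}" "l \<in> {1..b}" "k \<noteq> l" for i j k l
    using that \<open>b \<le> 3\<close> by auto
  show ?thesis
    using e
  proof (cases rule: B_graph_edge_cases)
    case e: (XX i j)
    show ?thesis
      using f
    proof (cases rule: B_graph_edge_cases)
      case f: (YY k l)
      \<comment> \<open>The shared index \<open>m\<close> gives the joining edge
        \<open>{X m, Y m}\<close>.\<close>
      then obtain m where "m \<in> {i, j}" "m \<in> {k, l}"
        using common e by blast
      then show ?thesis
        using e f B_graph_XY[of m b] by auto
    qed (use e XX in auto)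
  next
    case e: (YY i j)
    show ?thesis
      using f
    proof (cases rule: B_graph_edge_cases)
      case f: (XX k l)
      then obtain m where "m \<in> {i, j}" "m \<in> {k, l}"
        using common e by blast
      then show ?thesis
        using e f B_graph_XY[of m b] by (auto simp: insert_commute)
    qed (use e YY in auto)
  next
    case e: (XY i)
    show ?thesis
      using f by (cases rule: B_graph_edge_cases) (use e XX YY in auto)
  qed
qed

section \<open>Edges of the join of an edgeless graph with copies of \<open>H\<close>\<close>

lemma edges_join_copies:
  fixes H :: "'a graph"
  shows "edges (edgeless a \<nabla> copies n H) =
    {{Inl u, Inr (k, v)} | u k v. u \<in> {1..a} \<and> k \<in> {1..n} \<and> v \<in> verts H} \<union>
    {(\<lambda>v. Inr (k, v)) ` e | k e. k \<in> {1..n} \<and> e \<in> edges H}"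
proof -
  have "image g ` {f k e | k e. k \<in> K \<and> e \<in> E} = {g ` f k e | k e. k \<in> K \<and> e \<in> E}"
    for g :: "nat \<times> 'a \<Rightarrow> nat + nat \<times> 'a" and f :: "nat \<Rightarrow> 'a set \<Rightarrow> (nat \<times> 'a) set" and K E
    by blast
  from this[of Inr "\<lambda>k e. Pair k ` e" "{1..n}" "edges H"]
  have "image (Inr :: _ \<Rightarrow> nat + _) ` edges (copies n H) =
      {(\<lambda>v. Inr (k, v)) ` e | k e. k \<in> {1..n} \<and> e \<in> edges H}"
    by (simp add: copies_def image_image)
  moreover have "verts (copies n H) = {1..n} \<times> verts H"
    by (simp add: copies_def)
  moreover have "edges (edgeless a \<nabla> copies n H) =
      {{Inl u, Inr w} | u w. u \<in> {1..a} \<and> w \<in> verts (copies n H)} \<union>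
      image Inr ` edges (copies n H)"
    by (simp add: graph_join_def edgeless_def Un_commute)
  ultimately show ?thesis
    by simp
qed

lemma join_copies_edge_cases:
  assumes "e \<in> edges (edgeless a \<nabla> copies n H)"
  obtains (cross) u k v where "e = {Inl u, Inr (k, v)}" "u \<in> {1..a}" "k \<in> {1..n}" "v \<in> verts H"
    | (copy) k e' where "e = (\<lambda>v. Inr (k, v)) ` e'" "k \<in> {1..n}" "e' \<in> edges H"
  using assms unfolding edges_join_copies by blast

lemma join_copies_copyI:
  "k \<in> {1..n} \<Longrightarrow> {p, q} \<in> edges H \<Longrightarrow>
    {Inr (k, p), Inr (k, q)} \<in> edges (edgeless a \<nabla> copies n H)"
  unfolding edges_join_copies by force

lemma join_copies_crossI:
  "u \<in> {1..a} \<Longrightarrow> k \<in> {1..n} \<Longrightarrow> v \<in> verts H \<Longrightarrow>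
    {Inl u, Inr (k, v)} \<in> edges (edgeless a \<nabla> copies n H)"
  unfolding edges_join_copies by blast

text \<open>The \<open>Inl\<close> side has no edges of its own, and edges of \<open>H\<close> are
  nonempty. Both upper bounds use this to assign a copy to each matching edge.\<close>

lemma join_copies_edge_meets_copy:
  assumes "simple_graph H" "e \<in> edges (edgeless a \<nabla> copies n H)"
  obtains k v where "k \<in> {1..n}" "v \<in> verts H" "Inr (k, v) \<in> e"
  using assms(2)
proof (cases rule: join_copies_edge_cases)
  case (cross u k v)
  then show thesis using that[of k v] by simp
next
  case (copy k e')
  then have "e' \<subseteq> verts H" "e' \<noteq> {}"
    using assms(1) by (auto simp: simple_graph_def)
  then show thesis using that copy by auto
qed

section \<open>Upper bounds\<close>

lemma card_induced_matching_le_cliques: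
  assumes M: "induced_matching (G_graph a b n) M"
  shows "card M \<le> 2 * n"
proof -
  \<comment> \<open>The cliques are indexed by a constructor, \<open>X\<close> or \<open>Y\<close>,
    and the number of a copy.\<close>
  define C :: "(nat \<Rightarrow> bvert) \<Rightarrow> nat \<Rightarrow> (nat + nat \<times> bvert) set"
    where "C c k = {Inr (k, c i) | i. i \<in> {1..b}}" for c k
  have sub: "M \<subseteq> edges (edgeless a \<nabla> copies n (B_graph b))"
    using M by (simp add: induced_matching_def G_graph_def)
  have "X 0 \<noteq> Y 0" by simp
  then have XY: "X \<noteq> Y" by metis
  have "card M \<le> card ({X, Y} \<times> {1..n})"
  \<comment> \<open>A relation replaces a choice function: an edge may meet several cliques, but no
    clique meets two edges of \<open>M\<close>.\<close>
  proof (rule card_le_if_inj_on_rel[where r = "\<lambda>e (c, k). e \<inter> C c k \<noteq> {}"])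
    fix e assume "e \<in> M"
    then obtain k v where "k \<in> {1..n}" "v \<in> verts (B_graph b)" "Inr (k, v) \<in> e"
      using join_copies_edge_meets_copy[OF simple_graph_B_graph] sub by blast
    then show "\<exists>ck. ck \<in> {X, Y} \<times> {1..n} \<and> (case ck of (c, k) \<Rightarrow> e \<inter> C c k \<noteq> {})"
      unfolding C_def B_graph_def by fastforce
  next
    fix e f ck
    assume ef: "e \<in> M" "f \<in> M" and ck: "ck \<in> {X, Y} \<times> {1..n}"
      and "case ck of (c, k) \<Rightarrow> e \<inter> C c k \<noteq> {}" "case ck of (c, k) \<Rightarrow> f \<inter> C c k \<noteq> {}"
    then obtain c k i j where *: "c \<in> {X, Y}" "k \<in> {1..n}" "i \<in> {1..b}" "j \<in> {1..b}"
      "Inr (k, c i) \<in> e" "Inr (k, c j) \<in> f"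
      unfolding C_def by blast
    have "i = j \<or> {c i, c j} \<in> edges (B_graph b)"
      using * B_graph_XX[of i b j] B_graph_YY[of i b j] by auto
    then have "Inr (k, c i) = Inr (k, c j) \<or>
        {Inr (k, c i), Inr (k, c j)} \<in> edges (G_graph a b n)"
      using *(2) by (auto simp: G_graph_def intro: join_copies_copyI)
    then show "e = f"
      by (rule induced_matching_touching_eq[OF M ef(1) *(5) ef(2) *(6)])
  qed simp
  then show ?thesis
    using XY by (simp add: card_cartesian_product)
qed

text \<open>Distinct edges of \<open>M\<close> cannot meet the same copy: two edges inside it touch
  by \<open>touch\<close>, and an edge with an \<open>Inl\<close> end touches every edge.\<close>

lemma card_induced_matching_join_copies_le:
  assumes H: "simple_graph H"
    and touch: "\<And>e f. e \<in> edges H \<Longrightarrow> f \<in> edges H \<Longrightarrow> \<exists>p\<in>e. \<exists>q\<in>f. p = q \<or> {p, q} \<in> edges H"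
    and M: "induced_matching (edgeless a \<nabla> copies n H) M"
  shows "card M \<le> n"
proof -
  have edge: "e \<in> edges (edgeless a \<nabla> copies n H)" if "e \<in> M" for e
    using M that by (auto simp: induced_matching_def)
  \<comment> \<open>Every edge \<open>f\<close> has a vertex in some copy, and \<open>Inl u\<close>
    is adjacent to that vertex.\<close>
  have cross_eq: "e = f"
    if "e \<in> M" "f \<in> M" and e: "e = {Inl u, Inr w}" "u \<in> {1..a}" for e f u w
  proof -
    obtain k v where "k \<in> {1..n}" "v \<in> verts H" "Inr (k, v) \<in> f"
      using join_copies_edge_meets_copy[OF H edge[OF \<open>f \<in> M\<close>]] .
    with join_copies_crossI[of u a k n v H] e show ?thesis
      by (intro induced_matching_touching_eq[OF M \<open>e \<in> M\<close> _ \<open>f \<in> M\<close>, of "Inl u" "Inr (k, v)"]) auto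
  qed
  have "card M \<le> card {1..n}"
  proof (rule card_le_if_inj_on_rel[where r = "\<lambda>e k. \<exists>v\<in>verts H. Inr (k, v) \<in> e"])
    fix e assume "e \<in> M"
    then show "\<exists>k. k \<in> {1..n} \<and> (\<exists>v\<in>verts H. Inr (k, v) \<in> e)"
      using join_copies_edge_meets_copy[OF H] edge by metis
  next
    fix e f k
    assume ef: "e \<in> M" "f \<in> M" and k: "k \<in> {1..n}"
      and ek: "\<exists>v\<in>verts H. Inr (k, v) \<in> e" and fk: "\<exists>v\<in>verts H. Inr (k, v) \<in> f"
    show "e = f"
      using edge[OF ef(1)]
    proof (cases rule: join_copies_edge_cases)
      case cross
      then show ?thesis using cross_eq ef by blast
    next
      case e: (copy k1 e')
      show ?thesis
        using edge[OF ef(2)]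
      proof (cases rule: join_copies_edge_cases)
        case cross
        then show ?thesis using cross_eq ef by metis
      next
        case f: (copy k2 f')
        have "k1 = k" "k2 = k"
          using e f ek fk by auto
        obtain p q where "p \<in> e'" "q \<in> f'" "p = q \<or> {p, q} \<in> edges H"
          using touch e f by blast
        then show ?thesis
          using e f k \<open>k1 = k\<close> \<open>k2 = k\<close> join_copies_copyI[of k n p q H a]
          by (intro induced_matching_touching_eq[OF M ef(1) _ ef(2), of "Inr (k, p)" "Inr (k, q)"]) auto
      qed
    qed
  qed simp
  then show ?thesis by simp
qed

section \<open>Lower bounds\<close>

text \<open>Placing \<open>N\<close> in every copy stays induced because distinct copies are not
  adjacent and no \<open>Inl\<close> vertex is covered.\<close>

lemma induced_matching_join_copies:
  fixes a n :: nat
  assumes H: "simple_graph H" and N: "induced_matching H N"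
  defines "M \<equiv> (\<lambda>(k, e). (\<lambda>v. Inr (k, v)) ` e) ` ({1..n} \<times> N)"
  shows "induced_matching (edgeless a \<nabla> copies n H) M" "card M = n * card N"
proof -
  have NE: "N \<subseteq> edges H" and disj: "\<And>e f. e \<in> N \<Longrightarrow> f \<in> N \<Longrightarrow> e \<noteq> f \<Longrightarrow> e \<inter> f = {}"
    and ind: "\<And>e. e \<in> edges H \<Longrightarrow> e \<subseteq> \<Union>N \<Longrightarrow> e \<in> N"
    using N by (auto simp: induced_matching_def induced_subgraph_def)
  have ne: "e \<noteq> {}" if "e \<in> edges H" for e
    using H that by (auto simp: simple_graph_def)
  have ME: "M \<subseteq> edges (edgeless a \<nabla> copies n H)"
    using NE unfolding M_def edges_join_copies by fastforce
  \<comment> \<open>The second fact rules out the edges of the join; the first reduces edges inside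
    a copy to inducedness of \<open>N\<close>.\<close>
  have UM: "Inr (k, v) \<in> \<Union>M \<Longrightarrow> v \<in> \<Union>N" "Inl u \<notin> \<Union>M" for k v u
    by (auto simp: M_def)
  have "e \<in> M" if "e \<in> edges (edgeless a \<nabla> copies n H)" "e \<subseteq> \<Union>M" for e
    using that(1)
  proof (cases rule: join_copies_edge_cases)
    case cross
    then show ?thesis using UM(2) that(2) by blast
  next
    case (copy k e')
    then have "e' \<subseteq> \<Union>N" using UM(1) that(2) by blast
    then have "e' \<in> N" using ind copy by blast
    then show ?thesis using copy by (auto simp: M_def)
  qed
  moreover have "e \<inter> f = {}" if "e \<in> M" "f \<in> M" "e \<noteq> f" for e f
  proof -
    from that(1,2) obtain k e' l f' where *: "e' \<in> N" "f' \<in> N"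
      "e = (\<lambda>v. Inr (k, v)) ` e'" "f = (\<lambda>v. Inr (l, v)) ` f'"
      unfolding M_def by auto
    then have "k \<noteq> l \<or> e' \<inter> f' = {}"
      using disj[of e' f'] that(3) by blast
    then show ?thesis
      using *(3,4) by blast
  qed
  ultimately show "induced_matching (edgeless a \<nabla> copies n H) M"
    using ME by (auto simp: induced_matching_def induced_subgraph_def)
  have "inj_on (\<lambda>(k, e). (\<lambda>v. Inr (k, v) :: nat + nat \<times> 'a) ` e) ({1..n} \<times> N)"
  proof (rule inj_onI, clarify)
    fix k e l f
    assume *: "e \<in> N" "f \<in> N"
      "(\<lambda>v. Inr (k, v) :: nat + nat \<times> 'a) ` e = (\<lambda>v. Inr (l, v)) ` f"
    \<comment> \<open>An empty edge would have the same image in every copy; a nonempty one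
      determines its copy.\<close>
    have "e \<noteq> {}" using ne NE * by blast
    then have "k = l" using *(3) by blast
    moreover have "inj (\<lambda>v. Inr (k, v) :: nat + nat \<times> 'a)"
      by (simp add: inj_def)
    ultimately show "k = l \<and> e = f"
      using *(3) by (simp add: inj_image_eq_iff)
  qed
  then show "card M = n * card N"
    by (simp add: M_def card_image card_cartesian_product)
qed

lemma induced_matching_B_graph_single:
  assumes "b \<ge> 2"
  shows "induced_matching (B_graph b) {{X 1, X 2}}"
  using assms B_graph_XX[of 1 b 2]
  by (auto simp: induced_matching_def induced_subgraph_def doubleton_eq_iff elim!: B_graph_edge_cases)

text \<open>The index sets \<open>{1, 2}\<close> and \<open>{3, 4}\<close> are disjoint, so no edge
  \<open>{X i, Y i}\<close> has both ends covered; four indices make room for this.\<close>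

lemma induced_matching_B_graph_pair:
  assumes "b \<ge> 4"
  shows "induced_matching (B_graph b) {{X 1, X 2}, {Y 3, Y 4}}"
proof -
  let ?M = "{{X 1, X 2}, {Y 3, Y 4}}"
  have "e \<in> ?M" if "e \<in> edges (B_graph b)" "e \<subseteq> {X 1, X 2, Y 3, Y 4}" for e
    using that(1)
  proof (cases rule: B_graph_edge_cases)
    case (XX i j)
    then have "i = 1 \<and> j = 2 \<or> i = 2 \<and> j = 1" using that(2) by auto
    then show ?thesis using XX(1) by auto
  next
    case (YY i j)
    then have "i = 3 \<and> j = 4 \<or> i = 4 \<and> j = 3" using that(2) by auto
    then show ?thesis using YY(1) by auto
  next
    case (XY i)
    then show ?thesis using that(2) by auto
  qed
  moreover have "?M \<subseteq> edges (B_graph b)"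
    using assms B_graph_XX[of 1 b 2] B_graph_YY[of 3 b 4] by simp
  moreover have "\<Union>?M = {X 1, X 2, Y 3, Y 4}"
    by auto
  ultimately have "edges (induced_subgraph (B_graph b) (\<Union>?M)) = ?M"
    unfolding induced_subgraph_def by auto
  then show ?thesis
    using \<open>?M \<subseteq> edges (B_graph b)\<close> by (simp add: induced_matching_def)
qed

theorem theorem6p2:
  fixes a b n :: nat
  assumes "a \<ge> 1" and "b \<ge> 2" and "n \<ge> 1"
  shows "(b = 2 \<or> b = 3 \<longrightarrow> induced_matching_number (G_graph a b n) = n) \<and>
         (b \<ge> 4 \<longrightarrow> induced_matching_number (G_graph a b n) = 2 * n)"
proof (intro conjI impI)
  assume "b = 2 \<or> b = 3"
  then have "b \<le> 3" by auto
  note le = card_induced_matching_join_copies_le[OF simple_graph_B_graph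
      B_graph_edges_touch[OF \<open>b \<le> 3\<close>]]
  obtain M where M: "induced_matching (G_graph a b n) M" "card M = n"
    using induced_matching_join_copies[OF simple_graph_B_graph
        induced_matching_B_graph_single[OF \<open>b \<ge> 2\<close>]]
    by (fastforce simp: G_graph_def)
  show "induced_matching_number (G_graph a b n) = n"
    using induced_matching_number_eqI[OF simple_graph_G_graph M(1)] le M(2)
    by (simp add: G_graph_def)
next
  assume "b \<ge> 4"
  \<comment> \<open>Two distinct edges per copy give the factor 2.\<close>
  have "card {{X 1, X 2}, {Y 3, Y 4}} = 2"
    by (simp add: doubleton_eq_iff)
  then obtain M where M: "induced_matching (G_graph a b n) M" "card M = 2 * n"
    using induced_matching_join_copies[OF simple_graph_B_graph
        induced_matching_B_graph_pair[OF \<open>b \<ge> 4\<close>]]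
    by (fastforce simp: G_graph_def)
  show "induced_matching_number (G_graph a b n) = 2 * n"
    using induced_matching_number_eqI[OF simple_graph_G_graph M(1)]
      card_induced_matching_le_cliques M(2)
    by simp
qed

end
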